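(* Every Garside group is strongly translation discrete.
   Context: Garside monoids and groups. Let $M$ be a monoid. An atom of $M$ is an element $a\neq 1$ such that $a=bc$ with $b,c\in M$ implies $b=1$ or $c=1$. For $a\in M$ let $\|a\|$ be the supremum of the lengths of all expressions of $a$ as a product of atoms. $M$ is atomic if it is generated by its atoms and $\|a\|<\infty$ for all $a\in M$. In an atomic monoid one has partial orders: $a\leqslant_L b$ if $ac=b$ for some $c\in M$, and $a\leqslant_R b$ if $ca=b$ for some $c\in M$; put $L(a)=\{b: b\leqslant_L a\}$ and $R(a)=\{b: b\leqslant_R a\}$. An atomic monoid $M$ is a Garside monoid if it is finitely generated, left and right cancellative, $(M,\leqslant_L)$ and $(M,\leqslant_R)$ are lattices, and there exists an element $\Delta\in M$ (a Garside element) such that $L(\Delta)=R(\Delta)$ and this set generates $M$. A Garside monoid satisfies Ore's conditions and embeds in its group of fractions; a Garside group is the group of fractions of a Garside monoid. Translation numbers. Let $G$ be a finitely generated group and $X$ a finite set of semigroup generators for $G$. For a non-torsion element $g\in G$, its translation number with respect to $X$ is $t_X(g)=\lim_{n\to\infty}|g^n|_X/n$, where $|\cdot|_X$ is the shortest word length in the alphabet $X$. $t_X$ is constant on conjugacy classes. $G$ is translation separable if for some (equivalently, any) finite set $X$ of semigroup generators the translation numbers of all non-torsion elements are strictly positive. $G$ is strongly translation discrete if it is translation separable and for some (equivalently, any) finite set $X$ of semigroup generators for $G$ and for any real number $r$ the number of conjugacy classes $[g]$ in $G$ with $t_X(g)\leqslant r$ is finite. *)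

theory Defs
  imports Complex_Main "HOL-Library.Extended_Nat" "HOL-Algebra.Divisibility"
begin

section \<open>Garside monoids and their groups of fractions\<close>

definition word_prod :: "('a, 'b) monoid_scheme \<Rightarrow> 'a list \<Rightarrow> 'a"
  where "word_prod M ws = foldr (\<otimes>\<^bsub>M\<^esub>) ws \<one>\<^bsub>M\<^esub>"

definition monoid_generates :: "('a, 'b) monoid_scheme \<Rightarrow> 'a set \<Rightarrow> bool"
  where "monoid_generates M S \<longleftrightarrow> S \<subseteq> carrier M \<and>
    (\<forall>a \<in> carrier M. \<exists>ws. set ws \<subseteq> S \<and> word_prod M ws = a)"

definition atoms :: "('a, 'b) monoid_scheme \<Rightarrow> 'a set"
  where "atoms M = {a \<in> carrier M. a \<noteq> \<one>\<^bsub>M\<^esub> \<and>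
    (\<forall>b \<in> carrier M. \<forall>c \<in> carrier M. a = b \<otimes>\<^bsub>M\<^esub> c \<longrightarrow> b = \<one>\<^bsub>M\<^esub> \<or> c = \<one>\<^bsub>M\<^esub>)}"

definition atom_norm :: "('a, 'b) monoid_scheme \<Rightarrow> 'a \<Rightarrow> enat"
  where "atom_norm M a =
    (SUP ws \<in> {ws. set ws \<subseteq> atoms M \<and> word_prod M ws = a}. enat (length ws))"

locale atomic_monoid = monoid M for M (structure) +
  assumes atoms_generate: "monoid_generates M (atoms M)"
    and atom_norm_finite: "a \<in> carrier M \<Longrightarrow> atom_norm M a < \<infinity>"

definition leq_L :: "('a, 'b) monoid_scheme \<Rightarrow> 'a \<Rightarrow> 'a \<Rightarrow> bool"
  where "leq_L M a b \<longleftrightarrow> (\<exists>c \<in> carrier M. a \<otimes>\<^bsub>M\<^esub> c = b)"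

definition leq_R :: "('a, 'b) monoid_scheme \<Rightarrow> 'a \<Rightarrow> 'a \<Rightarrow> bool"
  where "leq_R M a b \<longleftrightarrow> (\<exists>c \<in> carrier M. c \<otimes>\<^bsub>M\<^esub> a = b)"

definition left_divisors :: "('a, 'b) monoid_scheme \<Rightarrow> 'a \<Rightarrow> 'a set"
  where "left_divisors M a = {b \<in> carrier M. leq_L M b a}"

definition right_divisors :: "('a, 'b) monoid_scheme \<Rightarrow> 'a \<Rightarrow> 'a set"
  where "right_divisors M a = {b \<in> carrier M. leq_R M b a}"

definition garside_element :: "('a, 'b) monoid_scheme \<Rightarrow> 'a \<Rightarrow> bool"
  where "garside_element M \<Delta> \<longleftrightarrow> \<Delta> \<in> carrier M \<and>
    left_divisors M \<Delta> = right_divisors M \<Delta> \<and> monoid_generates M (left_divisors M \<Delta>)"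

locale garside_monoid = atomic_monoid M + monoid_cancel M for M (structure) +
  assumes finitely_generated: "\<exists>S. finite S \<and> monoid_generates M S"
    and lattice_L: "lattice \<lparr>carrier = carrier M, eq = (=), le = leq_L M\<rparr>"
    and lattice_R: "lattice \<lparr>carrier = carrier M, eq = (=), le = leq_R M\<rparr>"
    and garside_element_exists: "\<exists>\<Delta>. garside_element M \<Delta>"

text \<open>
  The group of fractions of an Ore monoid \<open>M\<close> is determined, up to isomorphism over \<open>M\<close>, as a
  group \<open>G\<close> into which \<open>M\<close> embeds via \<open>\<iota>\<close> and each of whose elements is a fraction
  \<open>\<iota> a (\<iota> b)\<^sup>-\<^sup>1\<close>.  The orientation of the fractions is immaterial for Garside monoids, which
  satisfy the Ore conditions on both sides.  Preservation of \<open>\<one>\<close> by \<open>\<iota>\<close> is automatic since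
  \<open>G\<close> is a group.
\<close>
definition group_of_fractions ::
    "('m, 'c) monoid_scheme \<Rightarrow> ('a, 'b) monoid_scheme \<Rightarrow> ('m \<Rightarrow> 'a) \<Rightarrow> bool"
  where "group_of_fractions M G \<iota> \<longleftrightarrow> group G \<and> \<iota> \<in> hom M G \<and> inj_on \<iota> (carrier M) \<and>
    (\<forall>g \<in> carrier G. \<exists>a \<in> carrier M. \<exists>b \<in> carrier M. g = \<iota> a \<otimes>\<^bsub>G\<^esub> inv\<^bsub>G\<^esub> (\<iota> b))"


section \<open>Translation numbers\<close>

definition finite_semigroup_generators :: "('a, 'b) monoid_scheme \<Rightarrow> 'a set \<Rightarrow> bool"
  where "finite_semigroup_generators G X \<longleftrightarrow> finite X \<and> X \<subseteq> carrier G \<and>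
    (\<forall>g \<in> carrier G. \<exists>ws. ws \<noteq> [] \<and> set ws \<subseteq> X \<and> word_prod G ws = g)"

definition word_length :: "('a, 'b) monoid_scheme \<Rightarrow> 'a set \<Rightarrow> 'a \<Rightarrow> nat"
  where "word_length G X g =
    (LEAST n. \<exists>ws. set ws \<subseteq> X \<and> word_prod G ws = g \<and> length ws = n)"

definition translation_number :: "('a, 'b) monoid_scheme \<Rightarrow> 'a set \<Rightarrow> 'a \<Rightarrow> real"
  where "translation_number G X g =
    lim (\<lambda>n::nat. real (word_length G X (g [^]\<^bsub>G\<^esub> n)) / real n)"

definition nontorsion :: "('a, 'b) monoid_scheme \<Rightarrow> 'a set"
  where "nontorsion G = {g \<in> carrier G. \<forall>n::nat. n > 0 \<longrightarrow> g [^]\<^bsub>G\<^esub> n \<noteq> \<one>\<^bsub>G\<^esub>}"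

definition conjugacy_class :: "('a, 'b) monoid_scheme \<Rightarrow> 'a \<Rightarrow> 'a set"
  where "conjugacy_class G g = {h \<otimes>\<^bsub>G\<^esub> g \<otimes>\<^bsub>G\<^esub> inv\<^bsub>G\<^esub> h |h. h \<in> carrier G}"

text \<open>
  Both properties below are independent of the choice of the finite set \<open>X\<close> of semigroup generators.
  They are stated for every \<open>X\<close>, together with the requirement that some \<open>X\<close> exists.
\<close>
definition translation_separable :: "('a, 'b) monoid_scheme \<Rightarrow> bool"
  where "translation_separable G \<longleftrightarrow> (\<exists>X. finite_semigroup_generators G X) \<and>
    (\<forall>X. finite_semigroup_generators G X \<longrightarrow>
      (\<forall>g \<in> nontorsion G. translation_number G X g > 0))"

definition strongly_translation_discrete :: "('a, 'b) monoid_scheme \<Rightarrow> bool"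
  where "strongly_translation_discrete G \<longleftrightarrow> translation_separable G \<and>
    (\<forall>X. finite_semigroup_generators G X \<longrightarrow>
      (\<forall>r::real. finite (conjugacy_class G ` {g \<in> nontorsion G. translation_number G X g \<le> r})))"

end

theory Submission
  imports Defs
begin

text \<open>
  Order the Garside group \<open>G\<close> by \<open>a \<preceq> b \<longleftrightarrow> a\<^sup>-\<^sup>1 b \<in> M\<close>.  Finite meets exist, and left
  multiplication by any element as well as right multiplication by \<open>\<Delta>\<close> are lattice automorphisms.
  Saying that \<open>x\<^sup>-\<^sup>1 g x \<in> [\<Delta>\<^sup>-\<^sup>c, \<Delta>\<^sup>c]\<close> amounts to \<open>x \<preceq> g x \<Delta>\<^sup>c\<close> and \<open>x \<preceq> g\<^sup>-\<^sup>1 x \<Delta>\<^sup>c\<close>.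
  If the powers of \<open>g\<close> grow slowly enough, then \<open>T x = g x \<Delta>\<^sup>c\<close> satisfies \<open>y \<preceq> T\<^sup>n y\<close> for some
  \<open>n > 0\<close>, and the meet of \<open>y, T y, \<dots>, T\<^sup>n\<^sup>-\<^sup>1 y\<close> is an \<open>x\<close> with \<open>x \<preceq> T x\<close>.  Hence a bound
  on the translation number forces a conjugate of \<open>g\<close> into a fixed interval \<open>[\<Delta>\<^sup>-\<^sup>c, \<Delta>\<^sup>c]\<close>, which
  is finite.  Since the maps \<open>T\<close> belonging to different powers of \<open>g\<close> commute, a single \<open>x\<close>
  works for finitely many powers at once; for translation number \<open>0\<close> this makes \<open>g\<close> torsion.
\<close>

section \<open>Subadditive sequences\<close>

text \<open>Fekete's lemma: the limit is the infimum \<open>L\<close>. Dividing \<open>n\<close>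
  with remainder by an \<open>m\<close> whose quotient is nearly \<open>L\<close> bounds
  \<open>u n / n\<close> by \<open>u m / m\<close> plus a term that vanishes as \<open>n\<close>
  grows.\<close>

lemma subadditive_convergent:
  fixes u :: "nat \<Rightarrow> real"
  assumes sub: "\<And>m n. u (m + n) \<le> u m + u n" and nonneg: "\<And>n. 0 \<le> u n"
  shows "convergent (\<lambda>n. u n / real n)"
proof -
  define L where "L = (INF n\<in>{1..}. u n / real n)"
  have bdd: "bdd_below ((\<lambda>n. u n / real n) ` {1..})"
    by (rule bdd_belowI[of _ 0]) (auto simp: nonneg)
  have low: "L \<le> u n / real n" if "n \<ge> 1" for n
    unfolding L_def using bdd that by (auto intro!: cINF_lower)
  have mult: "u (q * m + r) \<le> real q * u m + u r" for q m r
  proof (induction q)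
    case (Suc q)
    have "u (Suc q * m + r) \<le> u m + u (q * m + r)"
      using sub[of m "q * m + r"] by (simp add: add.assoc)
    with Suc show ?case by (simp add: algebra_simps)
  qed simp
  have "(\<lambda>n. u n / real n) \<longlonglongrightarrow> L"
  proof (rule LIMSEQ_I)
    fix e :: real assume e: "e > 0"
    obtain m where m: "m \<ge> 1" "u m / real m < L + e / 2"
    proof -
      have "\<exists>x\<in>(\<lambda>n. u n / real n) ` {1..}. x < L + e / 2"
        unfolding L_def by (rule cInf_lessD) (use e in auto)
      then show ?thesis using that by auto
    qed
    \<comment> \<open>Bounds \<open>u\<close> on all remainders modulo \<open>m\<close>, by
      splitting \<open>r\<close> into ones; \<open>u 0\<close> stays since it may be
      positive.\<close>
    define B where "B = u 0 + real m * u 1"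
    have B: "u r \<le> B" if "r < m" for r
    proof -
      have "u r \<le> real r * u 1 + u 0" using mult[of r 1 0] by simp
      also have "\<dots> \<le> B" unfolding B_def using that nonneg[of 1]
        by (simp add: mult_right_mono)
      finally show ?thesis .
    qed
    obtain N :: nat where N: "real N > 2 * B / e" using reals_Archimedean2 by blast
    show "\<exists>no. \<forall>n\<ge>no. norm (u n / real n - L) < e"
    proof (intro exI[of _ "Suc N"] allI impI)
      fix n assume n: "n \<ge> Suc N"
      then have n0: "real n > 0" by simp
      have "u n \<le> real (n div m) * u m + u (n mod m)"
        using mult[of "n div m" m "n mod m"] by simp
      also have "\<dots> \<le> real n * (u m / real m) + B"
      proof (rule add_mono)
        have "real (n div m) * real m \<le> real n"
          by (metis div_times_less_eq_dividend of_nat_le_iff of_nat_mult)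
        then have "real (n div m) \<le> real n / real m" using m(1) by (simp add: field_simps)
        from mult_right_mono[OF this nonneg[of m]]
        show "real (n div m) * u m \<le> real n * (u m / real m)" by simp
        show "u (n mod m) \<le> B" using m(1) by (intro B) simp
      qed
      finally have "u n / real n \<le> u m / real m + B / real n"
        using n0 by (simp add: field_simps)
      moreover have "B / real n < e / 2"
      proof -
        have "2 * B / e < real n" using N n by linarith
        then show ?thesis using e n0 by (simp add: field_simps)
      qed
      ultimately have "u n / real n < L + e" using m(2) by linarith
      with low[of n] n show "norm (u n / real n - L) < e" by auto
    qed
  qed
  then show ?thesis by (auto simp: convergent_def)
qed


section \<open>Word length and translation numbers\<close>

lemma word_prod_Nil [simp]: "word_prod G [] = \<one>\<^bsub>G\<^esub>"
  by (simp add: word_prod_def)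

lemma word_prod_Cons [simp]: "word_prod G (w # ws) = w \<otimes>\<^bsub>G\<^esub> word_prod G ws"
  by (simp add: word_prod_def)

context monoid
begin

lemma word_prod_closed [simp]: "set ws \<subseteq> carrier G \<Longrightarrow> word_prod G ws \<in> carrier G"
  by (induction ws) auto

lemma word_prod_append:
  "set vs \<subseteq> carrier G \<Longrightarrow> set ws \<subseteq> carrier G \<Longrightarrow>
    word_prod G (vs @ ws) = word_prod G vs \<otimes> word_prod G ws"
  by (induction vs) (auto simp: m_assoc)

lemma word_length_le: "set ws \<subseteq> X \<Longrightarrow> word_length G X (word_prod G ws) \<le> length ws"
  unfolding word_length_def by (rule Least_le) auto

lemma word_length_attained:
  assumes "finite_semigroup_generators G X" "g \<in> carrier G"
  obtains ws where "set ws \<subseteq> X" "word_prod G ws = g" "length ws = word_length G X g"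
proof -
  have "\<exists>n ws. set ws \<subseteq> X \<and> word_prod G ws = g \<and> length ws = n"
    using assms unfolding finite_semigroup_generators_def by blast
  then have "\<exists>ws. set ws \<subseteq> X \<and> word_prod G ws = g \<and> length ws = word_length G X g"
    unfolding word_length_def by (rule LeastI_ex)
  then show ?thesis using that by blast
qed

lemma word_length_mult:
  assumes X: "finite_semigroup_generators G X" and "g \<in> carrier G" "h \<in> carrier G"
  shows "word_length G X (g \<otimes> h) \<le> word_length G X g + word_length G X h"
proof -
  obtain vs where vs: "set vs \<subseteq> X" "word_prod G vs = g" "length vs = word_length G X g"
    using word_length_attained assms by metis
  obtain ws where ws: "set ws \<subseteq> X" "word_prod G ws = h" "length ws = word_length G X h"
    using word_length_attained assms by metis
  have "X \<subseteq> carrier G" using X by (simp add: finite_semigroup_generators_def)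
  then have "word_prod G (vs @ ws) = g \<otimes> h"
    using vs ws word_prod_append[of vs ws] by auto
  then show ?thesis using word_length_le[of "vs @ ws" X] vs ws by simp
qed

text \<open>\<open>lim\<close> is meaningful only for a convergent sequence; concatenating words
  makes the length of \<open>g^n\<close> subadditive in \<open>n\<close>, so Fekete's lemma
  applies.\<close>

lemma translation_number_tendsto:
  assumes X: "finite_semigroup_generators G X" and g: "g \<in> carrier G"
  shows "(\<lambda>n. real (word_length G X (g [^] n)) / real n) \<longlonglongrightarrow> translation_number G X g"
proof -
  have "word_length G X (g [^] (m + n))
      \<le> word_length G X (g [^] m) + word_length G X (g [^] n)" for m n :: nat
    using word_length_mult[OF X, of "g [^] m" "g [^] n"] g by (simp add: nat_pow_mult)
  then have "convergent (\<lambda>n. real (word_length G X (g [^] n)) / real n)"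
    by (intro subadditive_convergent) (auto simp flip: of_nat_add)
  then show ?thesis by (simp add: translation_number_def convergent_LIMSEQ_iff)
qed

lemma translation_number_nonneg:
  assumes "finite_semigroup_generators G X" "g \<in> carrier G"
  shows "0 \<le> translation_number G X g"
  by (rule LIMSEQ_le_const[OF translation_number_tendsto[OF assms]]) auto

end

context group
begin

lemma inv_mult_cancel_left [simp]:
  "x \<in> carrier G \<Longrightarrow> y \<in> carrier G \<Longrightarrow> inv x \<otimes> (x \<otimes> y) = y"
  by (simp flip: m_assoc)

lemma mult_inv_cancel_left [simp]:
  "x \<in> carrier G \<Longrightarrow> y \<in> carrier G \<Longrightarrow> x \<otimes> (inv x \<otimes> y) = y"
  by (simp flip: m_assoc)

lemma conjugacy_class_conj:
  assumes "g \<in> carrier G" "x \<in> carrier G"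
  shows "conjugacy_class G (inv x \<otimes> g \<otimes> x) = conjugacy_class G g"
proof (intro equalityI subsetI)
  fix y assume "y \<in> conjugacy_class G (inv x \<otimes> g \<otimes> x)"
  then obtain h where h: "h \<in> carrier G" "y = h \<otimes> (inv x \<otimes> g \<otimes> x) \<otimes> inv h"
    by (auto simp: conjugacy_class_def)
  then have "y = (h \<otimes> inv x) \<otimes> g \<otimes> inv (h \<otimes> inv x)"
    using assms by (simp add: m_assoc inv_mult_group)
  then show "y \<in> conjugacy_class G g" unfolding conjugacy_class_def using h assms by blast
next
  fix y assume "y \<in> conjugacy_class G g"
  then obtain h where h: "h \<in> carrier G" "y = h \<otimes> g \<otimes> inv h"
    by (auto simp: conjugacy_class_def)
  then have "y = (h \<otimes> x) \<otimes> (inv x \<otimes> g \<otimes> x) \<otimes> inv (h \<otimes> x)"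
    using assms by (simp add: m_assoc inv_mult_group)
  then show "y \<in> conjugacy_class G (inv x \<otimes> g \<otimes> x)"
    unfolding conjugacy_class_def using h assms by blast
qed

end


section \<open>Groups with a Garside cone\<close>

text \<open>A Garside group seen from inside: \<open>P\<close> is the copy of the monoid,
  \<open>D\<close> that of the Garside element. Meets are demanded only for positive elements, and
  maximality only against positive lower bounds, because this is what the monoid supplies
  directly.\<close>

locale garside_cone = group G for G (structure) +
  fixes P :: "'a set" and D :: 'a
  assumes cone_subset: "P \<subseteq> carrier G"
    and cone_one [simp]: "\<one> \<in> P"
    and cone_mult: "a \<in> P \<Longrightarrow> b \<in> P \<Longrightarrow> a \<otimes> b \<in> P"
    and D_cone: "D \<in> P"
    and cone_conj_D: "p \<in> P \<Longrightarrow> inv D \<otimes> p \<otimes> D \<in> P"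
    and cone_conj_inv_D: "p \<in> P \<Longrightarrow> D \<otimes> p \<otimes> inv D \<in> P"
    and absorb: "g \<in> carrier G \<Longrightarrow> \<exists>k::nat. g \<otimes> D [^] k \<in> P"
    and cone_meet: "a \<in> P \<Longrightarrow> b \<in> P \<Longrightarrow>
      \<exists>m\<in>P. inv m \<otimes> a \<in> P \<and> inv m \<otimes> b \<in> P \<and>
        (\<forall>z\<in>P. inv z \<otimes> a \<in> P \<longrightarrow> inv z \<otimes> b \<in> P \<longrightarrow> inv z \<otimes> m \<in> P)"
    and finite_divisors: "p \<in> P \<Longrightarrow> finite {v \<in> P. inv v \<otimes> p \<in> P}"
begin

lemma cone_closed [simp]: "p \<in> P \<Longrightarrow> p \<in> carrier G"
  using cone_subset by blast

lemma D_closed [simp]: "D \<in> carrier G"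
  using D_cone by simp

lemma D_pow_cone [simp]: "D [^] (k::nat) \<in> P"
  by (induction k) (auto intro: cone_mult D_cone)

lemma cone_conj_D_pow: "p \<in> P \<Longrightarrow> inv (D [^] (k::nat)) \<otimes> p \<otimes> D [^] k \<in> P"
proof (induction k)
  case (Suc k)
  then show ?case using cone_conj_D[OF Suc.IH] by (simp add: m_assoc inv_mult_group)
qed simp

lemma cone_conj_inv_D_pow: "p \<in> P \<Longrightarrow> D [^] (k::nat) \<otimes> p \<otimes> inv (D [^] k) \<in> P"
proof (induction k arbitrary: p)
  case (Suc k)
  \<comment> \<open>The last factor of \<open>D [^] Suc k\<close> stands next to \<open>p\<close>,
    so the hypothesis is applied to the conjugate of \<open>p\<close> by \<open>D\<close>; hence
    \<open>p\<close> is arbitrary.\<close>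
  then show ?case using Suc.IH[OF cone_conj_inv_D] by (simp add: m_assoc inv_mult_group)
qed simp

section \<open>The left-invariant order defined by the cone\<close>

definition cone_le :: "'a \<Rightarrow> 'a \<Rightarrow> bool" (infix \<open>\<preceq>\<close> 50)
  where "a \<preceq> b \<longleftrightarrow> inv a \<otimes> b \<in> P"

lemma cone_le_refl: "a \<in> carrier G \<Longrightarrow> a \<preceq> a"
  by (simp add: cone_le_def)

lemma cone_le_trans:
  assumes "a \<preceq> b" "b \<preceq> c" "a \<in> carrier G" "b \<in> carrier G" "c \<in> carrier G"
  shows "a \<preceq> c"
proof -
  have "inv a \<otimes> c = (inv a \<otimes> b) \<otimes> (inv b \<otimes> c)" using assms by (simp add: m_assoc)
  then show ?thesis using assms by (simp add: cone_le_def cone_mult)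
qed

lemma cone_le_left_mult:
  "a \<in> carrier G \<Longrightarrow> b \<in> carrier G \<Longrightarrow> f \<in> carrier G \<Longrightarrow> f \<otimes> a \<preceq> f \<otimes> b \<longleftrightarrow> a \<preceq> b"
  by (simp add: cone_le_def inv_mult_group m_assoc)

text \<open>The quotient of \<open>a D^k\<close> and \<open>b D^k\<close> is a conjugate of
  \<open>inv a \<otimes> b\<close>, and \<open>P\<close> is stable under conjugation by
  \<open>D\<close> in both directions, one for each implication.\<close>

lemma cone_le_right_mult_D_pow:
  assumes "a \<in> carrier G" "b \<in> carrier G"
  shows "a \<otimes> D [^] (k::nat) \<preceq> b \<otimes> D [^] k \<longleftrightarrow> a \<preceq> b"
proof
  assume "a \<preceq> b"
  then show "a \<otimes> D [^] k \<preceq> b \<otimes> D [^] k"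
    using cone_conj_D_pow[of "inv a \<otimes> b" k] assms
    by (simp add: cone_le_def inv_mult_group m_assoc)
next
  assume "a \<otimes> D [^] k \<preceq> b \<otimes> D [^] k"
  then show "a \<preceq> b"
    using cone_conj_inv_D_pow[of "inv (a \<otimes> D [^] k) \<otimes> (b \<otimes> D [^] k)" k] assms
    by (simp add: cone_le_def inv_mult_group m_assoc)
qed

lemma absorb_mono:
  assumes "g \<otimes> D [^] (k::nat) \<in> P" "k \<le> l" "g \<in> carrier G"
  shows "g \<otimes> D [^] l \<in> P"
proof -
  have "g \<otimes> D [^] l = (g \<otimes> D [^] k) \<otimes> D [^] (l - k)"
    using assms by (simp add: m_assoc nat_pow_mult)
  then show ?thesis using assms by (simp add: cone_mult)
qed

lemma absorb_left:
  assumes "g \<otimes> D [^] (k::nat) \<in> P" "g \<in> carrier G"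
  shows "D [^] k \<otimes> g \<in> P"
  using cone_conj_inv_D_pow[OF assms(1), of k] assms by (simp add: m_assoc)

section \<open>Finite meets in the whole group, and subfixpoints\<close>

text \<open>Left translation by a power of \<open>D\<close> carries \<open>a\<close> and
  \<open>b\<close> into \<open>P\<close>, where \<open>cone_meet\<close> gives \<open>m\<close>.
  That meet is compared only with positive elements, so an arbitrary lower bound \<open>z\<close>
  needs a second translation by \<open>p\<close>; the meet \<open>q\<close> taken there links
  \<open>z\<close> to \<open>m\<close>.\<close>

lemma pair_meet:
  assumes a: "a \<in> carrier G" and b: "b \<in> carrier G"
  obtains m where "m \<in> carrier G" "m \<preceq> a" "m \<preceq> b"
    "\<And>z. z \<in> carrier G \<Longrightarrow> z \<preceq> a \<Longrightarrow> z \<preceq> b \<Longrightarrow> z \<preceq> m"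
proof -
  obtain k1 k2 :: nat where k: "a \<otimes> D [^] k1 \<in> P" "b \<otimes> D [^] k2 \<in> P"
    using absorb a b by meson
  define d where "d = D [^] (k1 + k2)"
  have d: "d \<in> P" by (simp add: d_def)
  have aP: "d \<otimes> a \<in> P" and bP: "d \<otimes> b \<in> P"
    unfolding d_def
    using absorb_left[OF absorb_mono[OF k(1) le_add1 a] a]
      absorb_left[OF absorb_mono[OF k(2) le_add2 b] b] by auto
  obtain m where m: "m \<in> P" "m \<preceq> d \<otimes> a" "m \<preceq> d \<otimes> b"
    and glb: "\<And>z. z \<in> P \<Longrightarrow> z \<preceq> d \<otimes> a \<Longrightarrow> z \<preceq> d \<otimes> b \<Longrightarrow> z \<preceq> m"
    using cone_meet[OF aP bP] unfolding cone_le_def by blast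
  show ?thesis
  proof
    show mc: "inv d \<otimes> m \<in> carrier G" using m d by simp
    show "inv d \<otimes> m \<preceq> a" "inv d \<otimes> m \<preceq> b"
      using cone_le_left_mult[OF mc a, of d] cone_le_left_mult[OF mc b, of d] m d by auto
    fix z assume z: "z \<in> carrier G" "z \<preceq> a" "z \<preceq> b"
    have zc: "d \<otimes> z \<in> carrier G" using z d by simp
    obtain j :: nat where j: "(d \<otimes> z) \<otimes> D [^] j \<in> P" using absorb zc by blast
    define p where "p = D [^] j"
    have p: "p \<in> P" by (simp add: p_def)
    have pz: "p \<otimes> (d \<otimes> z) \<in> P" unfolding p_def using absorb_left[OF j zc] .
    obtain q where q: "q \<in> P" "q \<preceq> p \<otimes> (d \<otimes> a)" "q \<preceq> p \<otimes> (d \<otimes> b)"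
      and qglb: "\<And>z. z \<in> P \<Longrightarrow> z \<preceq> p \<otimes> (d \<otimes> a) \<Longrightarrow> z \<preceq> p \<otimes> (d \<otimes> b) \<Longrightarrow> z \<preceq> q"
      using cone_meet[OF cone_mult[OF p aP] cone_mult[OF p bP]] unfolding cone_le_def by blast
    \<comment> \<open>\<open>p\<close> is a common lower bound of the translated pair because
      \<open>d \<otimes> a\<close> and \<open>d \<otimes> b\<close> are positive. Hence
      \<open>inv p \<otimes> q\<close> is positive and can be compared with
      \<open>m\<close>.\<close>
    have "p \<preceq> q" using p aP bP a b d by (intro qglb) (auto simp: cone_le_def)
    then have q': "inv p \<otimes> q \<in> P" by (simp add: cone_le_def)
    have "inv p \<otimes> q \<preceq> d \<otimes> a" "inv p \<otimes> q \<preceq> d \<otimes> b"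
      using cone_le_left_mult[of "inv p \<otimes> q" "d \<otimes> a" p] q p aP
        cone_le_left_mult[of "inv p \<otimes> q" "d \<otimes> b" p] bP by auto
    with q' have 1: "inv p \<otimes> q \<preceq> m" by (rule glb)
    have "p \<otimes> (d \<otimes> z) \<preceq> q"
      using p d a b z by (intro qglb pz) (simp_all add: cone_le_left_mult)
    then have 2: "d \<otimes> z \<preceq> inv p \<otimes> q"
      using cone_le_left_mult[of "d \<otimes> z" "inv p \<otimes> q" p] p zc q by simp
    have "d \<otimes> z \<preceq> m" by (rule cone_le_trans[OF 2 1 zc]) (use p q m in auto)
    then show "z \<preceq> inv d \<otimes> m"
      using cone_le_left_mult[of z "inv d \<otimes> m" d] z d m by simp
  qed
qed

lemma finite_meet:
  assumes "finite A" "A \<noteq> {}" "A \<subseteq> carrier G"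
  shows "\<exists>m\<in>carrier G. (\<forall>a\<in>A. m \<preceq> a) \<and>
    (\<forall>z\<in>carrier G. (\<forall>a\<in>A. z \<preceq> a) \<longrightarrow> z \<preceq> m)"
  using assms
proof (induction A rule: finite_ne_induct)
  case (singleton a)
  then show ?case by (auto intro: cone_le_refl)
next
  case (insert a A)
  then obtain m where m: "m \<in> carrier G" "\<And>b. b \<in> A \<Longrightarrow> m \<preceq> b"
    "\<And>z. z \<in> carrier G \<Longrightarrow> (\<forall>b\<in>A. z \<preceq> b) \<Longrightarrow> z \<preceq> m" by (metis insert_subset)
  obtain n where n: "n \<in> carrier G" "n \<preceq> a" "n \<preceq> m"
    "\<And>z. z \<in> carrier G \<Longrightarrow> z \<preceq> a \<Longrightarrow> z \<preceq> m \<Longrightarrow> z \<preceq> n"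
    using pair_meet[of a m] insert.prems m(1) by auto
  have "n \<preceq> b" if "b \<in> A" for b
    using cone_le_trans[OF n(3) m(2)[OF that] n(1) m(1)] insert.prems that by auto
  then show ?case using m n by (intro bexI[of _ n]) auto
qed

text \<open>
  The maps \<open>x \<mapsto> f x D\<^sup>c\<close> are commuting automorphisms of the lattice \<open>(G, \<preceq>)\<close>.  If \<open>y \<preceq> T\<^sup>n y\<close>
  for such a map \<open>T\<close>, then \<open>x = y \<and> T y \<and> \<dots> \<and> T\<^sup>n\<^sup>-\<^sup>1 y\<close> satisfies \<open>x \<preceq> T x\<close>, and \<open>x\<close> inherits
  from \<open>y\<close> the inequalities \<open>y \<preceq> T' y\<close> for the maps \<open>T'\<close> already treated.
\<close>
lemma simultaneous_subfixpoint:
  fixes c :: nat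
  assumes "finite F" "F \<subseteq> carrier G"
    and "\<And>f f'. f \<in> F \<Longrightarrow> f' \<in> F \<Longrightarrow> f \<otimes> f' = f' \<otimes> f"
    and "\<And>f y. f \<in> F \<Longrightarrow> y \<in> carrier G \<Longrightarrow> \<exists>n::nat>0. y \<preceq> f [^] n \<otimes> y \<otimes> D [^] (c * n)"
  shows "\<exists>x\<in>carrier G. \<forall>f\<in>F. x \<preceq> f \<otimes> x \<otimes> D [^] c"
  using assms
proof (induction F rule: finite_induct)
  case empty
  then show ?case by auto
next
  case (insert f F)
  have f: "f \<in> carrier G" and F: "F \<subseteq> carrier G" using insert.prems by auto
  obtain y where y: "y \<in> carrier G" "\<And>h. h \<in> F \<Longrightarrow> y \<preceq> h \<otimes> y \<otimes> D [^] c"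
  proof -
    have "\<exists>x\<in>carrier G. \<forall>f\<in>F. x \<preceq> f \<otimes> x \<otimes> D [^] c"
      by (rule insert.IH[OF F insert.prems(2,3)]) simp_all
    then show ?thesis using that by blast
  qed
  obtain n :: nat where n: "n > 0" "y \<preceq> f [^] n \<otimes> y \<otimes> D [^] (c * n)"
    using insert.prems(3)[of f y] y by auto
  define T where "T j = f [^] j \<otimes> y \<otimes> D [^] (c * j)" for j :: nat
  have Tc [simp]: "T j \<in> carrier G" for j using f y by (simp add: T_def)
  have TSuc: "T (Suc j) = f \<otimes> T j \<otimes> D [^] c" for j
  proof -
    have "f [^] Suc j = f \<otimes> f [^] j" using f nat_pow_Suc2 by blast
    moreover have "D [^] (c * Suc j) = D [^] (c * j) \<otimes> D [^] c"
      by (simp add: nat_pow_mult add.commute)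
    ultimately show ?thesis unfolding T_def using f y by (simp add: m_assoc)
  qed
  \<comment> \<open>Applying the automorphism \<open>u \<mapsto> f u D^c\<close> to both sides
    carries the inequality from \<open>T j\<close> to \<open>T (Suc j)\<close>, since
    \<open>f\<close> commutes with \<open>h\<close>.\<close>
  have comm: "T j \<preceq> h \<otimes> T j \<otimes> D [^] c" if h: "h \<in> F" for h j
  proof (induction j)
    case 0
    then show ?case using y h by (simp add: T_def)
  next
    case (Suc j)
    have hc: "h \<in> carrier G" using h F by auto
    have hf: "h \<otimes> f = f \<otimes> h" using insert.prems(2)[of h f] h by simp
    have "f \<otimes> T j \<otimes> D [^] c \<preceq> f \<otimes> (h \<otimes> T j \<otimes> D [^] c) \<otimes> D [^] c"
      using Suc.IH f hc by (simp add: cone_le_right_mult_D_pow cone_le_left_mult)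
    moreover have "f \<otimes> (h \<otimes> T j \<otimes> D [^] c) = h \<otimes> (f \<otimes> T j \<otimes> D [^] c)"
      using f hc hf by (simp flip: m_assoc)
    ultimately show ?case using f hc by (simp add: TSuc)
  qed
  obtain x where x: "x \<in> carrier G" "\<And>j. j < n \<Longrightarrow> x \<preceq> T j"
    "\<And>z. z \<in> carrier G \<Longrightarrow> (\<forall>j<n. z \<preceq> T j) \<Longrightarrow> z \<preceq> x"
  proof -
    have "finite (T ` {..<n})" "T ` {..<n} \<noteq> {}" "T ` {..<n} \<subseteq> carrier G" using n(1) by auto
    from finite_meet[OF this] obtain x where "x \<in> carrier G" "\<forall>a\<in>T ` {..<n}. x \<preceq> a"
      "\<forall>z\<in>carrier G. (\<forall>a\<in>T ` {..<n}. z \<preceq> a) \<longrightarrow> z \<preceq> x" by blast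
    then show ?thesis by (intro that[of x]) auto
  qed
  \<comment> \<open>The map \<open>u \<mapsto> h u D^c\<close> is an automorphism and so preserves
    meets: the preimage \<open>z\<close> of \<open>x\<close> lies below every \<open>T j\<close>,
    hence below \<open>x\<close>, and mapping back gives the claim.\<close>
  have key: "x \<preceq> h \<otimes> x \<otimes> D [^] c"
    if h: "h \<in> carrier G" and le: "\<And>j. j < n \<Longrightarrow> x \<preceq> h \<otimes> T j \<otimes> D [^] c" for h
  proof -
    define z where "z = inv h \<otimes> x \<otimes> inv (D [^] c)"
    have z: "z \<in> carrier G" "x = h \<otimes> z \<otimes> D [^] c" using h x(1) by (auto simp: z_def m_assoc)
    have "z \<preceq> T j" if "j < n" for j
    proof -
      have "h \<otimes> z \<otimes> D [^] c \<preceq> h \<otimes> T j \<otimes> D [^] c" using le[OF that] z(2) by simp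
      then show ?thesis using z(1) h by (simp add: cone_le_right_mult_D_pow cone_le_left_mult)
    qed
    then have "z \<preceq> x" using x(3) z(1) by blast
    then have "h \<otimes> z \<otimes> D [^] c \<preceq> h \<otimes> x \<otimes> D [^] c"
      using z(1) h x(1) by (simp add: cone_le_right_mult_D_pow cone_le_left_mult)
    then show ?thesis using z(2) by simp
  qed
  have "x \<preceq> f \<otimes> x \<otimes> D [^] c"
  proof (rule key[OF f])
    fix j assume j: "j < n"
    \<comment> \<open>For the last index, \<open>T n\<close> is not among the terms of the meet;
      there the inequality \<open>y \<preceq> T n\<close> closes the cycle, as \<open>x\<close> lies
      below \<open>T 0 = y\<close>.\<close>
    have "x \<preceq> T (Suc j)"
    proof (cases "Suc j < n")
      case True
      then show ?thesis using x(2) by blast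
    next
      case False
      then have "Suc j = n" using j by simp
      then have "y \<preceq> T (Suc j)" using n(2) by (simp add: T_def)
      moreover have "x \<preceq> y" using x(2)[of 0] n(1) y by (simp add: T_def)
      ultimately show ?thesis using cone_le_trans x(1) y(1) Tc by blast
    qed
    then show "x \<preceq> f \<otimes> T j \<otimes> D [^] c" by (simp add: TSuc)
  qed
  moreover have "x \<preceq> h \<otimes> x \<otimes> D [^] c" if h: "h \<in> F" for h
  proof (rule key)
    show hc: "h \<in> carrier G" using h F by auto
    show "x \<preceq> h \<otimes> T j \<otimes> D [^] c" if "j < n" for j
      using cone_le_trans[OF x(2)[OF that] comm[OF h]] x(1) hc by simp
  qed
  ultimately show ?case using x(1) by auto
qed

section \<open>Intervals between powers of \<open>D\<close>\<close>

text \<open>The order interval from \<open>D^-k\<close> to \<open>D^k\<close>: by conjugation,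
  \<open>g \<otimes> D [^] k \<in> P\<close> says that \<open>D^-k\<close> lies below
  \<open>g\<close>. In this form it is visibly closed under inversion.\<close>

definition interval :: "nat \<Rightarrow> 'a set"
  where "interval k = {g \<in> carrier G. g \<otimes> D [^] k \<in> P \<and> inv g \<otimes> D [^] k \<in> P}"

lemma interval_inv: "g \<in> interval k \<Longrightarrow> inv g \<in> interval k"
  by (simp add: interval_def)

lemma interval_mono: "k \<le> l \<Longrightarrow> interval k \<subseteq> interval l"
  by (auto simp: interval_def intro: absorb_mono)

lemma interval_exhaust:
  assumes "g \<in> carrier G"
  shows "\<exists>k. g \<in> interval k"
proof -
  obtain k l :: nat where "g \<otimes> D [^] k \<in> P" "inv g \<otimes> D [^] l \<in> P"
    using absorb[OF assms] absorb[OF inv_closed[OF assms]] by auto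
  then have "g \<in> interval (k + l)"
    using assms absorb_mono[of g k "k + l"] absorb_mono[of "inv g" l "k + l"]
    by (simp add: interval_def)
  then show ?thesis ..
qed

text \<open>Moving \<open>D^k\<close> past \<open>h\<close> costs a conjugation, which preserves
  \<open>P\<close>; so exponents add, and intervals behave like balls for a length function.\<close>

lemma absorb_mult:
  assumes "g \<in> carrier G" "h \<in> carrier G" "g \<otimes> D [^] (k::nat) \<in> P" "h \<otimes> D [^] (l::nat) \<in> P"
  shows "g \<otimes> h \<otimes> D [^] (k + l) \<in> P"
proof -
  have "D [^] (k + l) = D [^] l \<otimes> D [^] k" by (simp add: nat_pow_mult add.commute)
  then have "g \<otimes> h \<otimes> D [^] (k + l)
      = (g \<otimes> D [^] k) \<otimes> (inv (D [^] k) \<otimes> (h \<otimes> D [^] l) \<otimes> D [^] k)"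
    using assms(1,2) by (simp add: m_assoc)
  then show ?thesis using cone_mult cone_conj_D_pow assms by simp
qed

lemma interval_mult:
  assumes "g \<in> interval k" "h \<in> interval l"
  shows "g \<otimes> h \<in> interval (k + l)"
  using assms absorb_mult[of g h k l] absorb_mult[of "inv h" "inv g" l k]
  by (simp add: interval_def inv_mult_group add.commute)

text \<open>Right translation by \<open>D^c\<close> is injective and sends the interval into the set
  of positive divisors of \<open>D^(2c)\<close>.\<close>

lemma finite_interval: "finite (interval c)"
proof -
  have "(\<lambda>u. u \<otimes> D [^] c) ` interval c \<subseteq> {v \<in> P. inv v \<otimes> D [^] (c + c) \<in> P}"
  proof clarify
    fix u assume u: "u \<in> interval c"
    then have uc: "u \<in> carrier G" and uP: "u \<otimes> D [^] c \<in> P" "inv u \<otimes> D [^] c \<in> P"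
      by (auto simp: interval_def)
    have "inv (u \<otimes> D [^] c) \<otimes> D [^] (c + c) = inv (D [^] c) \<otimes> (inv u \<otimes> D [^] c) \<otimes> D [^] c"
      using uc by (simp add: inv_mult_group m_assoc nat_pow_mult)
    then show "u \<otimes> D [^] c \<in> P \<and> inv (u \<otimes> D [^] c) \<otimes> D [^] (c + c) \<in> P"
      using uP cone_conj_D_pow by simp
  qed
  then have "finite ((\<lambda>u. u \<otimes> D [^] c) ` interval c)"
    using finite_divisors finite_subset D_pow_cone by blast
  then show ?thesis
    by (rule finite_imageD) (auto simp: inj_on_def interval_def)
qed

section \<open>Conjugation into a fixed interval\<close>

text \<open>Reduces to \<open>simultaneous_subfixpoint\<close>: conjugating \<open>f^n\<close> by an
  element \<open>y\<close> of \<open>interval k\<close> adds at most \<open>2k\<close> to its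
  exponent, and \<open>growth\<close> has room for this within \<open>c * n\<close> because its
  slack is arbitrary.\<close>

lemma simultaneous_conjugate:
  fixes c :: nat
  assumes F: "finite F" "F \<subseteq> carrier G"
    and comm: "\<And>f f'. f \<in> F \<Longrightarrow> f' \<in> F \<Longrightarrow> f \<otimes> f' = f' \<otimes> f"
    and growth: "\<And>f k. f \<in> F \<Longrightarrow> \<exists>n::nat>0. \<exists>m. f [^] n \<in> interval m \<and> m + k \<le> c * n"
  shows "\<exists>x\<in>carrier G. \<forall>f\<in>F. inv x \<otimes> f \<otimes> x \<in> interval c"
proof -
  \<comment> \<open>The inequality \<open>x \<preceq> f x D^c\<close> is only one half of membership
    in the interval; the other half is the same inequality for \<open>inv f\<close>.\<close>
  let ?F = "F \<union> (\<lambda>f. inv f) ` F"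
  have comm_inv: "inv f \<otimes> f' = f' \<otimes> inv f" if "f \<in> F" "f' \<in> carrier G" "f \<otimes> f' = f' \<otimes> f" for f f'
  proof -
    have fc: "f \<in> carrier G" using F that by auto
    have "inv f \<otimes> f' = inv f \<otimes> (f' \<otimes> f) \<otimes> inv f" using fc that(2) by (simp add: m_assoc)
    also have "\<dots> = inv f \<otimes> (f \<otimes> f') \<otimes> inv f" by (simp only: that(3))
    also have "\<dots> = f' \<otimes> inv f" using fc that(2) by (simp add: m_assoc)
    finally show ?thesis .
  qed
  have comm': "f \<otimes> f' = f' \<otimes> f" if "f \<in> ?F" "f' \<in> ?F" for f f'
    using that
  proof (elim UnE imageE, goal_cases)
    case 1 then show ?case by (rule comm)
  next
    case (2 b) then show ?case using comm_inv[of b f] comm[of b f] F by auto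
  next
    case (3 b) then show ?case using comm_inv[of b f'] comm[of b f'] F by auto
  next
    case (4 a b)
    then have "inv b \<otimes> a = a \<otimes> inv b" using comm_inv[of b a] comm[of b a] F by auto
    then show ?case using 4 comm_inv[of a "inv b"] F by auto
  qed
  have grow': "\<exists>n::nat>0. \<exists>m. f [^] n \<in> interval m \<and> m + k \<le> c * n" if "f \<in> ?F" for f k
    using that
  proof (elim UnE imageE)
    assume "f \<in> F" then show ?thesis by (rule growth)
  next
    fix h assume h: "f = inv h" "h \<in> F"
    obtain n m :: nat where "n > 0" "h [^] n \<in> interval m" "m + k \<le> c * n"
      using growth[OF h(2), of k] by blast
    moreover have "f [^] n = inv (h [^] n)" using h F nat_pow_inv by auto
    ultimately show ?thesis using interval_inv by metis
  qed
  have "\<exists>n::nat>0. y \<preceq> f [^] n \<otimes> y \<otimes> D [^] (c * n)" if f: "f \<in> ?F" and y: "y \<in> carrier G" for f y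
  proof -
    have fc: "f \<in> carrier G" using f F by auto
    obtain k where k: "y \<in> interval k" using interval_exhaust y by blast
    obtain n m :: nat where n: "n > 0" "f [^] n \<in> interval m" "m + (k + k) \<le> c * n"
      using grow'[OF f, of "k + k"] by blast
    have "inv y \<otimes> f [^] n \<otimes> y \<in> interval (k + m + k)"
      using k n by (intro interval_mult interval_inv)
    then have "inv y \<otimes> f [^] n \<otimes> y \<in> interval (c * n)"
      using interval_mono[of "k + m + k" "c * n"] n by auto
    then have "y \<preceq> f [^] n \<otimes> y \<otimes> D [^] (c * n)"
      using y fc by (simp add: interval_def cone_le_def m_assoc)
    then show ?thesis using n by blast
  qed
  then have "\<exists>x\<in>carrier G. \<forall>f\<in>?F. x \<preceq> f \<otimes> x \<otimes> D [^] c"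
    using F by (intro simultaneous_subfixpoint comm') auto
  then obtain x where x: "x \<in> carrier G" "\<And>f. f \<in> ?F \<Longrightarrow> x \<preceq> f \<otimes> x \<otimes> D [^] c"
    by blast
  have "inv x \<otimes> f \<otimes> x \<in> interval c" if f: "f \<in> F" for f
  proof -
    have fc: "f \<in> carrier G" using f F by auto
    show ?thesis using x(1) x(2)[of f] x(2)[of "inv f"] f fc
      by (auto simp: interval_def cone_le_def inv_mult_group m_assoc)
  qed
  then show ?thesis using x(1) by blast
qed

section \<open>Word growth, translation numbers and intervals\<close>

text \<open>Being finite, \<open>X\<close> lies in a single interval, and exponents add along a
  word.\<close>

lemma word_interval:
  assumes "finite X" "X \<subseteq> carrier G"
  obtains K where "\<And>ws. set ws \<subseteq> X \<Longrightarrow> word_prod G ws \<in> interval (K * length ws)"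
proof -
  have "\<exists>K. X \<subseteq> interval K" using assms
  proof (induction X rule: finite_induct)
    case (insert x X)
    then obtain K L where "X \<subseteq> interval K" "x \<in> interval L"
      using interval_exhaust by (metis insert_subset)
    then have "insert x X \<subseteq> interval (K + L)"
      using interval_mono[of K "K + L"] interval_mono[of L "K + L"] by auto
    then show ?case ..
  qed simp
  then obtain K where K: "X \<subseteq> interval K" ..
  have "set ws \<subseteq> X \<Longrightarrow> word_prod G ws \<in> interval (K * length ws)" for ws
  proof (induction ws)
    case Nil
    then show ?case by (simp add: interval_def)
  next
    case (Cons w ws)
    then show ?case using interval_mult[of w K "word_prod G ws" "K * length ws"] K by auto
  qed
  then show ?thesis using that by blast
qed

text \<open>Provides the \<open>growth\<close> condition for \<open>g^i\<close>: the power
  \<open>g^(i n)\<close> lies in an interval whose exponent is \<open>K\<close> times its word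
  length, asymptotically \<open>K i t n\<close> for the translation number \<open>t\<close>. As
  \<open>K i t < c\<close>, the gap to \<open>c n\<close> grows linearly and exceeds any fixed
  \<open>k\<close>.\<close>

lemma power_growth:
  fixes c i :: nat
  assumes X: "finite_semigroup_generators G X" and g: "g \<in> carrier G" and i: "i > 0"
    and K: "\<And>ws. set ws \<subseteq> X \<Longrightarrow> word_prod G ws \<in> interval (K * length ws)"
    and t: "real K * real i * translation_number G X g < real c"
  shows "\<exists>n::nat>0. \<exists>m. (g [^] i) [^] n \<in> interval m \<and> m + k \<le> c * n"
proof -
  let ?w = "\<lambda>n. word_length G X (g [^] n)"
  have "(\<lambda>n. real (?w (i * n)) / real (i * n)) \<longlonglongrightarrow> translation_number G X g"
    using LIMSEQ_subseq_LIMSEQ[OF translation_number_tendsto[OF X g], of "\<lambda>n. i * n"] i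
    by (simp add: strict_mono_def o_def)
  then have "(\<lambda>n. real K * real i * (real (?w (i * n)) / real (i * n)) + real k / real n)
      \<longlonglongrightarrow> real K * real i * translation_number G X g + 0"
    by (intro tendsto_intros lim_const_over_n)
  with t have "\<forall>\<^sub>F n in sequentially.
      real K * real i * (real (?w (i * n)) / real (i * n)) + real k / real n < real c"
    by (intro order_tendstoD(2)) auto
  then have "\<forall>\<^sub>F n in sequentially. n > 0 \<and>
      real K * real i * (real (?w (i * n)) / real (i * n)) + real k / real n < real c"
    using eventually_gt_at_top[of 0] by eventually_elim auto
  then obtain n :: nat where n: "n > 0"
    "real K * real i * (real (?w (i * n)) / real (i * n)) + real k / real n < real c"
    using eventually_happens'[OF sequentially_bot] by blast
  then have "real K * real (?w (i * n)) + real k < real c * real n"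
    using i by (simp add: field_simps)
  then have "real (K * ?w (i * n) + k) < real (c * n)" by simp
  then have le: "K * ?w (i * n) + k \<le> c * n" by linarith
  obtain ws where "set ws \<subseteq> X" "word_prod G ws = g [^] (i * n)" "length ws = ?w (i * n)"
    using word_length_attained[OF X, of "g [^] (i * n)"] g by auto
  then have "(g [^] i) [^] n \<in> interval (K * ?w (i * n))"
    using K[of ws] g by (simp add: nat_pow_pow)
  then show ?thesis using n(1) le by blast
qed

lemma finite_classes_bounded_translation_number:
  assumes X: "finite_semigroup_generators G X"
  shows "finite (conjugacy_class G ` {g \<in> carrier G. translation_number G X g \<le> r})"
proof -
  obtain K where K: "\<And>ws. set ws \<subseteq> X \<Longrightarrow> word_prod G ws \<in> interval (K * length ws)"
    using word_interval X by (auto simp: finite_semigroup_generators_def)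
  \<comment> \<open>\<open>c\<close> depends on \<open>X\<close> and \<open>r\<close> but not on
    \<open>g\<close>, so all classes in question meet one finite interval.\<close>
  obtain c :: nat where c: "real K * r < real c" using reals_Archimedean2 by blast
  have "conjugacy_class G g \<in> conjugacy_class G ` interval c"
    if g: "g \<in> carrier G" and t: "translation_number G X g \<le> r" for g
  proof -
    have "real K * translation_number G X g \<le> real K * r" using t by (simp add: mult_left_mono)
    then have "real K * real 1 * translation_number G X g < real c" using c by simp
    from power_growth[OF X g _ K this]
    have "\<exists>n::nat>0. \<exists>m. g [^] n \<in> interval m \<and> m + k \<le> c * n" for k using g by simp
    then obtain x where "x \<in> carrier G" "inv x \<otimes> g \<otimes> x \<in> interval c"
      using simultaneous_conjugate[of "{g}" c] g by auto
    then show ?thesis using conjugacy_class_conj[of g x] g by (metis imageI)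
  qed
  then have "conjugacy_class G ` {g \<in> carrier G. translation_number G X g \<le> r}
      \<subseteq> conjugacy_class G ` interval c" by auto
  then show ?thesis using finite_interval finite_subset by blast
qed

text \<open>
  If the translation number vanishes, then for every \<open>N\<close> one conjugation moves \<open>g, \<dots>, g\<^sup>N\<close> into
  the finite set \<open>interval 1\<close>, which does not depend on \<open>N\<close>; so two of these powers coincide.
\<close>
lemma translation_number_pos:
  assumes X: "finite_semigroup_generators G X" and g: "g \<in> nontorsion G"
  shows "translation_number G X g > 0"
proof (rule ccontr)
  assume "\<not> translation_number G X g > 0"
  have gc: "g \<in> carrier G" using g by (simp add: nontorsion_def)
  then have t0: "translation_number G X g = 0"
    using translation_number_nonneg[OF X gc] \<open>\<not> _\<close> by simp
  obtain K where K: "\<And>ws. set ws \<subseteq> X \<Longrightarrow> word_prod G ws \<in> interval (K * length ws)"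
    using word_interval X by (auto simp: finite_semigroup_generators_def)
  \<comment> \<open>One exponent more than \<open>interval 1\<close> has elements, for the
    pigeonhole principle; starting at 1 keeps every \<open>i\<close> positive, as
    \<open>power_growth\<close> requires.\<close>
  let ?I = "{1..Suc (card (interval 1))}"
  let ?F = "(\<lambda>i. g [^] i) ` ?I"
  have "\<exists>n::nat>0. \<exists>m. f [^] n \<in> interval m \<and> m + k \<le> 1 * n" if f: "f \<in> ?F" for f k
  proof -
    obtain i where "i \<in> ?I" "f = g [^] i" using f by blast
    \<comment> \<open>With translation number 0 the bound in \<open>power_growth\<close> reads
      \<open>0 < c\<close>, so \<open>c = 1\<close> works for every \<open>i\<close> at
      once.\<close>
    then show ?thesis using power_growth[OF X gc _ K, of i 1 k] t0 by simp
  qed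
  then have "\<exists>x\<in>carrier G. \<forall>f\<in>?F. inv x \<otimes> f \<otimes> x \<in> interval 1"
    using gc by (intro simultaneous_conjugate) (auto simp: nat_pow_mult add.commute)
  then obtain x where x: "x \<in> carrier G" "\<And>i. i \<in> ?I \<Longrightarrow> inv x \<otimes> g [^] i \<otimes> x \<in> interval 1"
    by auto
  have "\<not> inj_on (\<lambda>i. inv x \<otimes> g [^] i \<otimes> x) ?I"
  proof
    assume "inj_on (\<lambda>i. inv x \<otimes> g [^] i \<otimes> x) ?I"
    then have "card ?I \<le> card (interval 1)"
      by (rule card_inj_on_le) (use x finite_interval in auto)
    then show False by simp
  qed
  then obtain i j :: nat where "i \<noteq> j" "inv x \<otimes> g [^] i \<otimes> x = inv x \<otimes> g [^] j \<otimes> x"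
    unfolding inj_on_def by blast
  then have ij: "i \<noteq> j" "g [^] i = g [^] j" using x(1) gc by (auto simp: m_assoc)
  \<comment> \<open>Subtraction on naturals truncates: one difference is 0, the other is positive
    and contradicts non-torsion. Stating both avoids fixing which exponent is larger.\<close>
  have "g [^] (i - j) = \<one>" "g [^] (j - i) = \<one>"
    using pow_eq_div2[OF gc ij(2)] pow_eq_div2[OF gc ij(2)[symmetric]] by auto
  then show False using g ij(1) by (auto simp: nontorsion_def) (metis nat_neq_iff zero_less_diff)
qed

end


section \<open>The positive cone of a Garside group\<close>

text \<open>In a word over \<open>S\<close> that equals an atom, the first letter or the rest is
  trivial; peeling off trivial letters ends at a letter equal to the atom. Thus a finitely generated
  monoid has finitely many atoms.\<close>

lemma (in monoid) atoms_subset_generators: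
  assumes S: "monoid_generates G S"
  shows "atoms G \<subseteq> S"
proof
  fix a assume a: "a \<in> atoms G"
  have Sc: "S \<subseteq> carrier G" using S by (simp add: monoid_generates_def)
  have "set ws \<subseteq> S \<Longrightarrow> word_prod G ws \<in> atoms G \<Longrightarrow> word_prod G ws \<in> S" for ws
  proof (induction ws)
    case Nil
    then show ?case by (simp add: atoms_def)
  next
    case (Cons s ws)
    have c: "s \<in> carrier G" "word_prod G ws \<in> carrier G" using Cons.prems Sc by auto
    then have "s = \<one> \<or> word_prod G ws = \<one>" using Cons.prems by (auto simp: atoms_def)
    then show ?case using Cons c by auto
  qed
  moreover obtain ws where "set ws \<subseteq> S" "word_prod G ws = a"
    using S a by (auto simp: monoid_generates_def atoms_def)
  ultimately show "a \<in> S" using a by blast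
qed

context atomic_monoid
begin

text \<open>An atom word for a left divisor extends to one for \<open>a\<close>, so its length is at
  most the norm \<open>N\<close>; over finitely many atoms there are finitely many such
  words.\<close>

lemma finite_left_divisors:
  assumes S: "finite S" "monoid_generates M S" and a: "a \<in> carrier M"
  shows "finite (left_divisors M a)"
proof -
  have atoms: "finite (atoms M)" using finite_subset[OF atoms_subset_generators] S by blast
  have ac: "atoms M \<subseteq> carrier M" by (auto simp: atoms_def)
  obtain N where N: "atom_norm M a = enat N" using atom_norm_finite[OF a] by auto
  have "left_divisors M a \<subseteq> word_prod M ` {ws. set ws \<subseteq> atoms M \<and> length ws \<le> N}"
  proof
    fix v assume "v \<in> left_divisors M a"
    then obtain w where vw: "v \<in> carrier M" "w \<in> carrier M" "v \<otimes> w = a"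
      by (auto simp: left_divisors_def leq_L_def)
    obtain vs ws where vs: "set vs \<subseteq> atoms M" "word_prod M vs = v"
      and ws: "set ws \<subseteq> atoms M" "word_prod M ws = w"
      using atoms_generate vw by (metis monoid_generates_def)
    have "word_prod M (vs @ ws) = a" using word_prod_append[of vs ws] vs ws ac vw by auto
    then have "enat (length (vs @ ws)) \<le> atom_norm M a"
      unfolding atom_norm_def using vs ws by (intro SUP_upper) auto
    then have "length vs \<le> N" using N by simp
    then show "v \<in> word_prod M ` {ws. set ws \<subseteq> atoms M \<and> length ws \<le> N}" using vs by auto
  qed
  then show ?thesis using finite_lists_length_le[OF atoms, of N] finite_subset by blast
qed

end

section \<open>Commutation with the Garside element\<close>

context monoid
begin

text \<open>For a divisor \<open>s\<close> of \<open>D\<close> take complements twice: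
  \<open>s t = D\<close> and \<open>t u = D\<close>, possible since \<open>t\<close> is a right and
  therefore also a left divisor. Then \<open>s D = s t u = D u\<close>; the other side is symmetric.
  The divisors generate, so induction on words reaches every \<open>a\<close>.\<close>

lemma garside_element_commute:
  assumes D: "garside_element G D" and a: "a \<in> carrier G"
  shows "\<exists>b\<in>carrier G. a \<otimes> D = D \<otimes> b" "\<exists>b\<in>carrier G. D \<otimes> a = b \<otimes> D"
proof -
  have Dc: "D \<in> carrier G" and LR: "left_divisors G D = right_divisors G D"
    using D by (auto simp: garside_element_def)
  obtain ws where ws: "set ws \<subseteq> left_divisors G D" "word_prod G ws = a"
    using D a unfolding garside_element_def monoid_generates_def by blast
  have wc: "set vs \<subseteq> left_divisors G D \<Longrightarrow> word_prod G vs \<in> carrier G" for vs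
    by (rule word_prod_closed) (auto simp: left_divisors_def)
  have left: "\<exists>t\<in>left_divisors G D. s \<otimes> t = D" if s: "s \<in> left_divisors G D" for s
  proof -
    obtain t where "t \<in> carrier G" "s \<otimes> t = D" "s \<in> carrier G"
      using s by (auto simp: left_divisors_def leq_L_def)
    then show ?thesis unfolding LR by (auto simp: right_divisors_def leq_R_def)
  qed
  have right: "\<exists>t\<in>left_divisors G D. t \<otimes> s = D" if s: "s \<in> left_divisors G D" for s
  proof -
    obtain t where "t \<in> carrier G" "t \<otimes> s = D" "s \<in> carrier G"
      using s unfolding LR by (auto simp: right_divisors_def leq_R_def)
    then show ?thesis by (auto simp: left_divisors_def leq_L_def)
  qed
  have Lc: "s \<in> carrier G" if "s \<in> left_divisors G D" for s
    using that by (simp add: left_divisors_def)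
  have gen1: "\<exists>u\<in>carrier G. s \<otimes> D = D \<otimes> u" if s: "s \<in> left_divisors G D" for s
  proof -
    obtain t where t: "t \<in> left_divisors G D" "s \<otimes> t = D" using left s by blast
    obtain u where u: "u \<in> left_divisors G D" "t \<otimes> u = D" using left t by blast
    have "s \<otimes> D = s \<otimes> (t \<otimes> u)" using u by simp
    also have "\<dots> = (s \<otimes> t) \<otimes> u" using Lc[OF s] Lc[OF t(1)] Lc[OF u(1)] by (simp add: m_assoc)
    also have "\<dots> = D \<otimes> u" using t by simp
    finally show ?thesis using t u Lc by auto
  qed
  have gen2: "\<exists>u\<in>carrier G. D \<otimes> s = u \<otimes> D" if s: "s \<in> left_divisors G D" for s
  proof -
    obtain t where t: "t \<in> left_divisors G D" "t \<otimes> s = D" using right s by blast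
    obtain u where u: "u \<in> left_divisors G D" "u \<otimes> t = D" using right t by blast
    have "D \<otimes> s = (u \<otimes> t) \<otimes> s" using u by simp
    also have "\<dots> = u \<otimes> (t \<otimes> s)" using Lc[OF s] Lc[OF t(1)] Lc[OF u(1)] by (simp add: m_assoc)
    also have "\<dots> = u \<otimes> D" using t by simp
    finally show ?thesis using t u Lc by auto
  qed
  have "set vs \<subseteq> left_divisors G D \<Longrightarrow>
      \<exists>b\<in>carrier G. word_prod G vs \<otimes> D = D \<otimes> b" for vs
  proof (induction vs)
    case Nil
    then show ?case using Dc by (auto intro!: bexI[of _ \<one>])
  next
    case (Cons s vs)
    then obtain b u where b: "b \<in> carrier G" "word_prod G vs \<otimes> D = D \<otimes> b"
      and u: "u \<in> carrier G" "s \<otimes> D = D \<otimes> u" using gen1[of s] by auto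
    have c: "s \<in> carrier G" "word_prod G vs \<in> carrier G" using Cons.prems Lc wc by auto
    have "word_prod G (s # vs) \<otimes> D = s \<otimes> (D \<otimes> b)" using c Dc b(2) by (simp add: m_assoc)
    also have "\<dots> = (s \<otimes> D) \<otimes> b" using c Dc b(1) by (simp add: m_assoc)
    also have "\<dots> = D \<otimes> (u \<otimes> b)" unfolding u(2) using u(1) Dc b(1) by (simp add: m_assoc)
    finally show ?case using u b by blast
  qed
  then show "\<exists>b\<in>carrier G. a \<otimes> D = D \<otimes> b" using ws by blast
  have "set vs \<subseteq> left_divisors G D \<Longrightarrow>
      \<exists>b\<in>carrier G. D \<otimes> word_prod G vs = b \<otimes> D" for vs
  proof (induction vs)
    case Nil
    then show ?case using Dc by (auto intro!: bexI[of _ \<one>])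
  next
    case (Cons s vs)
    then obtain b u where b: "b \<in> carrier G" "D \<otimes> word_prod G vs = b \<otimes> D"
      and u: "u \<in> carrier G" "D \<otimes> s = u \<otimes> D" using gen2[of s] by auto
    have c: "s \<in> carrier G" "word_prod G vs \<in> carrier G" using Cons.prems Lc wc by auto
    have "D \<otimes> word_prod G (s # vs) = (D \<otimes> s) \<otimes> word_prod G vs" using c Dc by (simp add: m_assoc)
    also have "\<dots> = u \<otimes> (D \<otimes> word_prod G vs)" unfolding u(2) using c Dc u(1) by (simp add: m_assoc)
    also have "\<dots> = (u \<otimes> b) \<otimes> D" unfolding b(2) using u(1) Dc b(1) by (simp add: m_assoc)
    finally show ?case using u b by blast
  qed
  then show "\<exists>b\<in>carrier G. D \<otimes> a = b \<otimes> D" using ws by blast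
qed

lemma garside_element_pow_commute:
  assumes D: "garside_element G D" and a: "a \<in> carrier G"
  shows "\<exists>b\<in>carrier G. a \<otimes> D [^] (k::nat) = D [^] k \<otimes> b"
proof (induction k)
  case 0
  then show ?case using a by auto
next
  case (Suc k)
  have Dc: "D \<in> carrier G" using D by (simp add: garside_element_def)
  obtain b where b: "b \<in> carrier G" "a \<otimes> D [^] k = D [^] k \<otimes> b" using Suc by blast
  obtain c where c: "c \<in> carrier G" "b \<otimes> D = D \<otimes> c" using garside_element_commute[OF D b(1)] by blast
  have "a \<otimes> D [^] Suc k = (a \<otimes> D [^] k) \<otimes> D" using a Dc by (simp add: m_assoc)
  also have "\<dots> = D [^] k \<otimes> (b \<otimes> D)" unfolding b(2) using b(1) Dc by (simp add: m_assoc)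
  also have "\<dots> = D [^] Suc k \<otimes> c" unfolding c(2) using c(1) Dc by (simp add: m_assoc)
  finally show ?case using c(1) by blast
qed

text \<open>Each letter \<open>s\<close> has a complement \<open>t\<close> with
  \<open>s t = D\<close>, and \<open>t\<close> moves past \<open>D^k\<close> by turning into some
  \<open>t'\<close>. So a word of length \<open>k\<close> divides \<open>D^k\<close>; this will
  clear denominators.\<close>

lemma divides_garside_element_pow:
  assumes D: "garside_element G D" and a: "a \<in> carrier G"
  shows "\<exists>k::nat. \<exists>b\<in>carrier G. a \<otimes> b = D [^] k"
proof -
  have Dc: "D \<in> carrier G" using D by (simp add: garside_element_def)
  obtain ws where ws: "set ws \<subseteq> left_divisors G D" "word_prod G ws = a"
    using D a unfolding garside_element_def monoid_generates_def by blast
  have wc: "set vs \<subseteq> left_divisors G D \<Longrightarrow> word_prod G vs \<in> carrier G" for vs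
    by (rule word_prod_closed) (auto simp: left_divisors_def)
  have "set vs \<subseteq> left_divisors G D \<Longrightarrow>
      \<exists>k::nat. \<exists>b\<in>carrier G. word_prod G vs \<otimes> b = D [^] k" for vs
  proof (induction vs)
    case Nil
    then show ?case by (auto intro!: exI[of _ "0::nat"])
  next
    case (Cons s vs)
    obtain k :: nat and b where b: "b \<in> carrier G" "word_prod G vs \<otimes> b = D [^] k"
      using Cons by auto
    obtain t where t: "s \<in> carrier G" "t \<in> carrier G" "s \<otimes> t = D"
      using Cons.prems by (auto simp: left_divisors_def leq_L_def)
    obtain t' where t': "t' \<in> carrier G" "t \<otimes> D [^] k = D [^] k \<otimes> t'"
      using garside_element_pow_commute[OF D t(2)] by blast
    have c: "word_prod G vs \<in> carrier G" using Cons.prems wc by auto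
    have "word_prod G (s # vs) \<otimes> (b \<otimes> t') = s \<otimes> ((word_prod G vs \<otimes> b) \<otimes> t')"
      using c t b(1) t'(1) by (simp add: m_assoc)
    also have "\<dots> = s \<otimes> (t \<otimes> D [^] k)" unfolding b(2) t'(2) ..
    also have "\<dots> = D [^] Suc k" using t Dc nat_pow_Suc2[OF Dc, of k] by (simp flip: m_assoc)
    finally show ?case using b(1) t'(1) by blast
  qed
  then show ?thesis using ws by blast
qed

end

section \<open>Passage to the group of fractions\<close>

lemma garside_monoid_meet:
  assumes "garside_monoid M" "a \<in> carrier M" "b \<in> carrier M"
  obtains m where "m \<in> carrier M" "leq_L M m a" "leq_L M m b"
    "\<And>z. z \<in> carrier M \<Longrightarrow> leq_L M z a \<Longrightarrow> leq_L M z b \<Longrightarrow> leq_L M z m"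
proof -
  interpret garside_monoid M by fact
  interpret L: lattice "\<lparr>carrier = carrier M, eq = (=), le = leq_L M\<rparr>" by (rule lattice_L)
  let ?m = "meet \<lparr>carrier = carrier M, eq = (=), le = leq_L M\<rparr> a b"
  show ?thesis
    using that[of ?m] L.meet_closed[of a b] L.meet_left[of a b] L.meet_right[of a b]
      L.meet_le[of _ a b] assms(2,3) by auto
qed

lemma garside_group_cone:
  assumes M: "garside_monoid M" and fr: "group_of_fractions M G \<iota>"
    and D: "garside_element M D"
  shows "garside_cone G (\<iota> ` carrier M) (\<iota> D)"
proof -
  interpret M: garside_monoid M by fact
  interpret G: group G using fr by (simp add: group_of_fractions_def)
  let ?P = "\<iota> ` carrier M"
  have hom: "\<iota> \<in> hom M G" and inj: "inj_on \<iota> (carrier M)"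
    using fr by (auto simp: group_of_fractions_def)
  have ic [simp]: "\<iota> a \<in> carrier G" if "a \<in> carrier M" for a
    using hom that by (auto simp: hom_def)
  have im: "\<iota> (a \<otimes>\<^bsub>M\<^esub> b) = \<iota> a \<otimes>\<^bsub>G\<^esub> \<iota> b" if "a \<in> carrier M" "b \<in> carrier M" for a b
    using hom that by (auto simp: hom_def)
  have i1: "\<iota> \<one>\<^bsub>M\<^esub> = \<one>\<^bsub>G\<^esub>"
    using im[of "\<one>\<^bsub>M\<^esub>" "\<one>\<^bsub>M\<^esub>"] G.l_cancel_one[of "\<iota> \<one>\<^bsub>M\<^esub>" "\<iota> \<one>\<^bsub>M\<^esub>"] by simp
  have Dc [simp]: "D \<in> carrier M" using D by (simp add: garside_element_def)
  have ipow: "\<iota> (D [^]\<^bsub>M\<^esub> k) = \<iota> D [^]\<^bsub>G\<^esub> k" for k :: nat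
    by (induction k) (simp_all add: i1 im)
  \<comment> \<open>The dictionary between cone and monoid: injectivity of \<open>\<iota>\<close>
    turns membership of a quotient in the cone into left divisibility in \<open>M\<close>, from
    which meets and finiteness are read off.\<close>
  have frac: "inv\<^bsub>G\<^esub> (\<iota> a) \<otimes>\<^bsub>G\<^esub> \<iota> b = \<iota> c \<longleftrightarrow> b = a \<otimes>\<^bsub>M\<^esub> c"
    if "a \<in> carrier M" "b \<in> carrier M" "c \<in> carrier M" for a b c
  proof -
    have "inv\<^bsub>G\<^esub> (\<iota> a) \<otimes>\<^bsub>G\<^esub> \<iota> b = \<iota> c \<longleftrightarrow> \<iota> b = \<iota> (a \<otimes>\<^bsub>M\<^esub> c)"
      using that G.inv_solve_left'[of "\<iota> c" "\<iota> a" "\<iota> b"] by (auto simp: im)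
    also have "\<dots> \<longleftrightarrow> b = a \<otimes>\<^bsub>M\<^esub> c" using that inj by (auto simp: inj_on_def)
    finally show ?thesis .
  qed
  have le: "inv\<^bsub>G\<^esub> (\<iota> a) \<otimes>\<^bsub>G\<^esub> \<iota> b \<in> ?P \<longleftrightarrow> leq_L M a b"
    if "a \<in> carrier M" "b \<in> carrier M" for a b
    using frac[OF that] by (auto simp: leq_L_def image_iff)
  show ?thesis
  proof unfold_locales
    show "?P \<subseteq> carrier G" by auto
    show "\<one>\<^bsub>G\<^esub> \<in> ?P" using i1 by (metis M.one_closed imageI)
    show "a \<otimes>\<^bsub>G\<^esub> b \<in> ?P" if "a \<in> ?P" "b \<in> ?P" for a b
      using that by (auto simp flip: im)
    show "\<iota> D \<in> ?P" by simp
    show "inv\<^bsub>G\<^esub> (\<iota> D) \<otimes>\<^bsub>G\<^esub> p \<otimes>\<^bsub>G\<^esub> \<iota> D \<in> ?P" if p: "p \<in> ?P" for p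
    proof -
      obtain a where a: "a \<in> carrier M" "p = \<iota> a" using p by auto
      obtain b where b: "b \<in> carrier M" "a \<otimes>\<^bsub>M\<^esub> D = D \<otimes>\<^bsub>M\<^esub> b"
        using M.garside_element_commute[OF D a(1)] by blast
      have "inv\<^bsub>G\<^esub> (\<iota> D) \<otimes>\<^bsub>G\<^esub> p \<otimes>\<^bsub>G\<^esub> \<iota> D = inv\<^bsub>G\<^esub> (\<iota> D) \<otimes>\<^bsub>G\<^esub> \<iota> (a \<otimes>\<^bsub>M\<^esub> D)"
        using a by (simp add: im G.m_assoc)
      also have "\<dots> = \<iota> b" using a b frac[of D "a \<otimes>\<^bsub>M\<^esub> D" b] by simp
      finally show ?thesis using b by simp
    qed
    show "\<iota> D \<otimes>\<^bsub>G\<^esub> p \<otimes>\<^bsub>G\<^esub> inv\<^bsub>G\<^esub> (\<iota> D) \<in> ?P" if p: "p \<in> ?P" for p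
    proof -
      obtain a where a: "a \<in> carrier M" "p = \<iota> a" using p by auto
      obtain b where b: "b \<in> carrier M" "D \<otimes>\<^bsub>M\<^esub> a = b \<otimes>\<^bsub>M\<^esub> D"
        using M.garside_element_commute[OF D a(1)] by blast
      have "\<iota> D \<otimes>\<^bsub>G\<^esub> p \<otimes>\<^bsub>G\<^esub> inv\<^bsub>G\<^esub> (\<iota> D) = \<iota> (b \<otimes>\<^bsub>M\<^esub> D) \<otimes>\<^bsub>G\<^esub> inv\<^bsub>G\<^esub> (\<iota> D)"
        using a im[of D a] by (simp flip: b(2))
      also have "\<dots> = \<iota> b" using b(1) by (simp add: im G.m_assoc)
      finally show ?thesis using b by simp
    qed
    show "\<exists>k::nat. g \<otimes>\<^bsub>G\<^esub> \<iota> D [^]\<^bsub>G\<^esub> k \<in> ?P" if g: "g \<in> carrier G" for g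
    proof -
      obtain a b where ab: "a \<in> carrier M" "b \<in> carrier M" "g = \<iota> a \<otimes>\<^bsub>G\<^esub> inv\<^bsub>G\<^esub> (\<iota> b)"
        using fr g unfolding group_of_fractions_def by blast
      \<comment> \<open>A right multiple of the denominator \<open>b\<close> is a power of
        \<open>D\<close>, so \<open>D^k\<close> on the right cancels it and leaves the positive
        element \<open>\<iota> (a c)\<close>.\<close>
      obtain k :: nat and c where c: "c \<in> carrier M" "b \<otimes>\<^bsub>M\<^esub> c = D [^]\<^bsub>M\<^esub> k"
        using M.divides_garside_element_pow[OF D ab(2)] by blast
      have "g \<otimes>\<^bsub>G\<^esub> \<iota> D [^]\<^bsub>G\<^esub> k = \<iota> a \<otimes>\<^bsub>G\<^esub> (inv\<^bsub>G\<^esub> (\<iota> b) \<otimes>\<^bsub>G\<^esub> \<iota> (b \<otimes>\<^bsub>M\<^esub> c))"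
        using ab by (simp add: c(2) ipow G.m_assoc)
      also have "\<dots> = \<iota> (a \<otimes>\<^bsub>M\<^esub> c)" using ab(1,2) c(1) by (simp add: im)
      finally show ?thesis using ab c by blast
    qed
    show "\<exists>m\<in>?P. inv\<^bsub>G\<^esub> m \<otimes>\<^bsub>G\<^esub> a \<in> ?P \<and> inv\<^bsub>G\<^esub> m \<otimes>\<^bsub>G\<^esub> b \<in> ?P \<and>
        (\<forall>z\<in>?P. inv\<^bsub>G\<^esub> z \<otimes>\<^bsub>G\<^esub> a \<in> ?P \<longrightarrow> inv\<^bsub>G\<^esub> z \<otimes>\<^bsub>G\<^esub> b \<in> ?P \<longrightarrow>
          inv\<^bsub>G\<^esub> z \<otimes>\<^bsub>G\<^esub> m \<in> ?P)"
      if ab: "a \<in> ?P" "b \<in> ?P" for a b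
    proof -
      obtain x y where xy: "x \<in> carrier M" "a = \<iota> x" "y \<in> carrier M" "b = \<iota> y"
        using ab by auto
      obtain m where m: "m \<in> carrier M" "leq_L M m x" "leq_L M m y"
        "\<And>z. z \<in> carrier M \<Longrightarrow> leq_L M z x \<Longrightarrow> leq_L M z y \<Longrightarrow> leq_L M z m"
        using garside_monoid_meet[OF M xy(1,3)] by blast
      show ?thesis by (rule bexI[of _ "\<iota> m"]) (use m xy le in auto)
    qed
    show "finite {v \<in> ?P. inv\<^bsub>G\<^esub> v \<otimes>\<^bsub>G\<^esub> p \<in> ?P}" if p: "p \<in> ?P" for p
    proof -
      obtain a where a: "a \<in> carrier M" "p = \<iota> a" using p by auto
      have "finite (left_divisors M a)"
        using M.finitely_generated M.finite_left_divisors a(1) by blast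
      moreover have "{v \<in> ?P. inv\<^bsub>G\<^esub> v \<otimes>\<^bsub>G\<^esub> p \<in> ?P} \<subseteq> \<iota> ` left_divisors M a"
        using a le by (auto simp: left_divisors_def)
      ultimately show ?thesis using finite_surj by blast
    qed
  qed
qed

text \<open>Elements of \<open>G\<close> are fractions, so images of generators and their inverses
  reach everything. Semigroup words must be nonempty, so the identity is adjoined and prefixed to
  each word.\<close>

lemma fractions_finite_semigroup_generators:
  assumes fr: "group_of_fractions M G \<iota>" and "monoid M"
    and S: "finite S" "monoid_generates M S"
  shows "finite_semigroup_generators G
    (insert \<one>\<^bsub>G\<^esub> (\<iota> ` S \<union> (\<lambda>s. inv\<^bsub>G\<^esub> (\<iota> s)) ` S))"
proof -
  interpret M: monoid M by fact
  interpret G: group G using fr by (simp add: group_of_fractions_def)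
  let ?X = "insert \<one>\<^bsub>G\<^esub> (\<iota> ` S \<union> (\<lambda>s. inv\<^bsub>G\<^esub> (\<iota> s)) ` S)"
  have hom: "\<iota> \<in> hom M G" using fr by (auto simp: group_of_fractions_def)
  have ic [simp]: "\<iota> a \<in> carrier G" if "a \<in> carrier M" for a
    using hom that by (auto simp: hom_def)
  have im: "\<iota> (a \<otimes>\<^bsub>M\<^esub> b) = \<iota> a \<otimes>\<^bsub>G\<^esub> \<iota> b" if "a \<in> carrier M" "b \<in> carrier M" for a b
    using hom that by (auto simp: hom_def)
  have i1: "\<iota> \<one>\<^bsub>M\<^esub> = \<one>\<^bsub>G\<^esub>"
    using im[of "\<one>\<^bsub>M\<^esub>" "\<one>\<^bsub>M\<^esub>"] G.l_cancel_one[of "\<iota> \<one>\<^bsub>M\<^esub>" "\<iota> \<one>\<^bsub>M\<^esub>"] by simp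
  have Sc: "S \<subseteq> carrier M" using S by (simp add: monoid_generates_def)
  have X: "?X \<subseteq> carrier G" using Sc by auto
  define H where "H = {word_prod G ws | ws. set ws \<subseteq> ?X}"
  have HX: "x \<in> H" if "x \<in> ?X" for x
  proof -
    have "word_prod G [x] = x" "set [x] \<subseteq> ?X" using that X by auto
    then show ?thesis unfolding H_def by (metis (mono_tags, lifting) mem_Collect_eq)
  qed
  have Hm: "x \<otimes>\<^bsub>G\<^esub> y \<in> H" if xy: "x \<in> H" "y \<in> H" for x y
  proof -
    obtain vs ws where "set vs \<subseteq> ?X" "word_prod G vs = x" "set ws \<subseteq> ?X" "word_prod G ws = y"
      using xy unfolding H_def by blast
    then have "set (vs @ ws) \<subseteq> ?X" "word_prod G (vs @ ws) = x \<otimes>\<^bsub>G\<^esub> y"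
      using G.word_prod_append[OF order_trans[OF _ X] order_trans[OF _ X], of vs ws] by auto
    then show ?thesis unfolding H_def by (metis (mono_tags, lifting) mem_Collect_eq)
  qed
  have word: "\<iota> (word_prod M ws) \<in> H \<and> inv\<^bsub>G\<^esub> (\<iota> (word_prod M ws)) \<in> H"
    if "set ws \<subseteq> S" for ws
    using that
  proof (induction ws)
    case Nil
    then show ?case using HX[of "\<one>\<^bsub>G\<^esub>"] by (simp add: i1)
  next
    case (Cons w ws)
    have c: "w \<in> carrier M" "word_prod M ws \<in> carrier M" using Cons.prems Sc by auto
    have "\<iota> w \<in> H" "inv\<^bsub>G\<^esub> (\<iota> w) \<in> H" using HX Cons.prems by auto
    then show ?case using Cons c by (simp add: im Hm G.inv_mult_group)
  qed
  have "\<exists>ws. ws \<noteq> [] \<and> set ws \<subseteq> ?X \<and> word_prod G ws = g" if g: "g \<in> carrier G" for g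
  proof -
    obtain a b where ab: "a \<in> carrier M" "b \<in> carrier M" "g = \<iota> a \<otimes>\<^bsub>G\<^esub> inv\<^bsub>G\<^esub> (\<iota> b)"
      using fr g unfolding group_of_fractions_def by blast
    then have "\<iota> a \<in> H" "inv\<^bsub>G\<^esub> (\<iota> b) \<in> H"
      using word S(2) unfolding monoid_generates_def by metis+
    then have "g \<in> H" using ab(3) Hm by simp
    then obtain ws where ws: "set ws \<subseteq> ?X" "word_prod G ws = g" unfolding H_def by blast
    then show ?thesis using g by (intro exI[of _ "\<one>\<^bsub>G\<^esub> # ws"]) auto
  qed
  then show ?thesis using X S(1) by (simp add: finite_semigroup_generators_def)
qed

theorem mainTheorem1:
  fixes M :: "('m, 'c) monoid_scheme" and G :: "('a, 'b) monoid_scheme" and \<iota> :: "'m \<Rightarrow> 'a"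
  assumes "garside_monoid M"
    and "group_of_fractions M G \<iota>"
  shows "strongly_translation_discrete G"
proof -
  interpret M: garside_monoid M by fact
  obtain D where "garside_element M D" using M.garside_element_exists by blast
  then interpret garside_cone G "\<iota> ` carrier M" "\<iota> D"
    by (rule garside_group_cone[OF assms])
  have "\<exists>X. finite_semigroup_generators G X"
    using M.finitely_generated fractions_finite_semigroup_generators[OF assms(2) M.monoid_axioms]
    by blast
  moreover have "finite (conjugacy_class G ` {g \<in> nontorsion G. translation_number G X g \<le> r})"
    if "finite_semigroup_generators G X" for X r
    using finite_classes_bounded_translation_number[OF that, of r]
    by (rule finite_subset[rotated]) (auto simp: nontorsion_def)
  ultimately show ?thesis
    using translation_number_pos
    by (auto simp: strongly_translation_discrete_def translation_separable_def)
qed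

end
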